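(* Fix an integer $k > 0$ and a sequence $(b_1, b_2, \ldots, b_k)$ of nonnegative integers. Then there exists $n \geq 0$ such that $b_i(n) = b_i$ for all $1 \leq i \leq k$ and $b_i(n) = 0$ for all $i > k$ if and only if for every $1 \leq i \leq k$ we have $b_i \leq i$ and \[ \sum_{j=i}^{k} b_j \equiv 0 \pmod{i}. \]
   Context: Tchoukaillon boards. For each $n \geq 0$ define a sequence $b(n) = (b_1(n), b_2(n), \ldots)$ of nonnegative integers recursively: $b(0)$ is the all-zero sequence; given $b(n)$, let $p(n) = \min\{j \geq 1 : b_j(n) = 0\}$ and set $b_i(n+1) = b_i(n)$ if $i > p(n)$, $b_i(n+1) = i$ if $i = p(n)$, and $b_i(n+1) = b_i(n) - 1$ if $i < p(n)$. Here $b_i(n)$ is the number of stones in bin $i$ of the unique winning Tchoukaillon board with $n$ stones in total. *)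

theory Defs
  imports "HOL-Number_Theory.Cong"
begin

text \<open>
  \<open>tchoukaillon n i\<close> is $b_i(n)$, the number of stones in bin \<open>i\<close> of the winning board with
  \<open>n\<close> stones. Bins are numbered from 1; the value at index 0 carries no meaning and is always 0.
  Every board has finitely many nonempty bins, so the minimum in \<open>first_empty\<close> exists. The
  truncated subtraction is exact in the bins \<open>1 \<le> i < first_empty c\<close>, as these are nonempty.
\<close>

definition first_empty :: "(nat \<Rightarrow> nat) \<Rightarrow> nat" where
  "first_empty c = (LEAST j. j \<ge> 1 \<and> c j = 0)"

primrec tchoukaillon :: "nat \<Rightarrow> nat \<Rightarrow> nat" where
  "tchoukaillon 0 = (\<lambda>i. 0)"
| "tchoukaillon (Suc n) =
    (let c = tchoukaillon n; p = first_empty c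
     in (\<lambda>i. if i > p then c i else if i = p then i else c i - 1))"

end

theory Submission
  imports Defs
begin

text \<open>
  Sowing from the first empty bin \<open>p\<close> raises the tail sum $\sum_{j \ge i} b_j$ by \<open>i\<close> for every
  \<open>i \<le> p\<close> and leaves the other tail sums unchanged, so the bounds and divisibilities hold on every
  board. Conversely, they force $b_i$ to be the remainder of $\sum_{j \ge i} b_j$ modulo $i + 1$,
  so the sequence is determined by its total, hence equals the board with that many stones.
\<close>

definition sow :: "(nat \<Rightarrow> nat) \<Rightarrow> nat \<Rightarrow> nat" where
  "sow c = (\<lambda>i. if i > first_empty c then c i else if i = first_empty c then i else c i - 1)"

lemma tchoukaillon_Suc: "tchoukaillon (Suc n) = sow (tchoukaillon n)"
  by (simp add: sow_def Let_def)

lemma first_empty: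
  assumes "m \<ge> 1" "c m = 0"
  shows "first_empty c \<ge> 1" "c (first_empty c) = 0" "first_empty c \<le> m"
    "\<And>i. 1 \<le> i \<Longrightarrow> i < first_empty c \<Longrightarrow> c i > 0"
  using LeastI[of "\<lambda>j. j \<ge> 1 \<and> c j = 0" m] Least_le[of "\<lambda>j. j \<ge> 1 \<and> c j = 0" m]
    not_less_Least[of _ "\<lambda>j. j \<ge> 1 \<and> c j = 0"] assms
  unfolding first_empty_def by auto

text \<open>With \<open>p\<close> the first empty bin, a tail starting at \<open>i\<close> \<le>
  \<open>p\<close> loses one stone from each of the \<open>p - i\<close> nonempty bins before
  \<open>p\<close> and gains \<open>p\<close> stones at \<open>p\<close>, a net gain of
  \<open>i\<close>. The empty bin \<open>m\<close> forces \<open>p\<close> \<le> \<open>N\<close>,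
  so this gain lies inside the sum. The downward induction starts from the empty sum at
  \<open>Suc N\<close>.\<close>

lemma sum_sow:
  assumes "1 \<le> m" "m \<le> N" "c m = 0" "1 \<le> i" "i \<le> Suc N"
  shows "(\<Sum>j=i..N. sow c j) = (\<Sum>j=i..N. c j) + (if i \<le> first_empty c then i else 0)"
  using \<open>i \<le> Suc N\<close> \<open>1 \<le> i\<close>
proof (induction i rule: inc_induct)
  case base
  then show ?case using first_empty(3)[of m c, OF assms(1,3)] assms(2) by simp
next
  case (step i)
  have "i \<le> N" using step.hyps by simp
  moreover have "c i = 0" if "i \<le> first_empty c" "\<not> Suc i \<le> first_empty c"
    using that first_empty(2)[of m c, OF assms(1,3)] by (metis le_antisym not_less_eq_eq)
  ultimately show ?case
    using step.IH step.prems first_empty(2)[of m c, OF assms(1,3)]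
      first_empty(4)[of m c i, OF assms(1,3)]
    by (auto simp: sum.atLeast_Suc_atMost sow_def)
qed

text \<open>Bin \<open>Suc n\<close> is still empty after \<open>n\<close> moves, so the next move
  fills a bin no further out than that.\<close>

lemma tchoukaillon_eq_0: "i > n \<Longrightarrow> tchoukaillon n i = 0"
proof (induction n arbitrary: i)
  case (Suc n)
  have "first_empty (tchoukaillon n) \<le> Suc n"
    by (rule first_empty(3)) (simp_all add: Suc.IH)
  then show ?case using Suc by (simp add: tchoukaillon_Suc sow_def del: tchoukaillon.simps)
qed simp

text \<open>The cutoff \<open>N\<close> is a parameter so that a board with \<open>n\<close> stones
  and a sequence of length \<open>k\<close> can be compared over a common range.\<close>

definition tails_divisible :: "nat \<Rightarrow> (nat \<Rightarrow> nat) \<Rightarrow> bool" where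
  "tails_divisible N c \<longleftrightarrow> (\<forall>i\<in>{1..N}. c i \<le> i \<and> i dvd (\<Sum>j=i..N. c j))"

lemma tails_divisible_tchoukaillon:
  assumes "n \<le> N"
  shows "tails_divisible N (tchoukaillon n) \<and> (\<Sum>j=1..N. tchoukaillon n j) = n"
  using assms
proof (induction n)
  case 0
  then show ?case by (simp add: tails_divisible_def)
next
  case (Suc n)
  have z: "tchoukaillon n (Suc n) = 0"
    by (simp add: tchoukaillon_eq_0)
  have p: "1 \<le> first_empty (tchoukaillon n)"
    using first_empty(1)[of "Suc n" "tchoukaillon n"] z by simp
  have s: "(\<Sum>j=i..N. sow (tchoukaillon n) j)
      = (\<Sum>j=i..N. tchoukaillon n j) + (if i \<le> first_empty (tchoukaillon n) then i else 0)"
    if "1 \<le> i" "i \<le> Suc N" for i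
    using sum_sow[of "Suc n" N "tchoukaillon n" i] Suc.prems z that by simp
  have "sow (tchoukaillon n) i \<le> i" if "tchoukaillon n i \<le> i" for i
    using that by (auto simp: sow_def)
  then show ?case
    using Suc p s by (simp add: tchoukaillon_Suc tails_divisible_def del: tchoukaillon.simps)
qed

lemma tails_divisible_eq_mod:
  assumes "tails_divisible N c" "i \<in> {1..N}"
  shows "c i = (\<Sum>j=i..N. c j) mod Suc i"
proof -
  \<comment> \<open>For \<open>i = N\<close> this tail is empty, and its sum 0 is divisible by
    anything.\<close>
  have "Suc i dvd (\<Sum>j=Suc i..N. c j)"
    using assms by (cases "i = N") (auto simp: tails_divisible_def)
  moreover have "(\<Sum>j=i..N. c j) = c i + (\<Sum>j=Suc i..N. c j)"
    using assms by (simp add: sum.atLeast_Suc_atMost)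
  moreover have "c i < Suc i"
    using assms by (auto simp: tails_divisible_def less_Suc_eq_le)
  ultimately show ?thesis
    by (metis dvd_def mod_less mod_mult_self2)
qed

text \<open>The tail sum from \<open>i\<close> fixes the entry at \<open>i\<close> as a remainder;
  subtracting that entry gives the tail sum from \<open>Suc i\<close>. Starting from the equal
  totals, all entries agree.\<close>

lemma tails_divisible_unique:
  assumes "tails_divisible N c" "tails_divisible N d" "(\<Sum>j=1..N. c j) = (\<Sum>j=1..N. d j)"
    and "i \<in> {1..N}"
  shows "c i = d i"
proof -
  have "1 \<le> i" "i \<le> N" using assms(4) by auto
  then have "(\<Sum>j=i..N. c j) = (\<Sum>j=i..N. d j)"
  proof (induction i rule: dec_induct)
    case base
    then show ?case using assms(3) by simp
  next
    case (step i)
    then have i: "i \<in> {1..N}" and eq: "(\<Sum>j=i..N. c j) = (\<Sum>j=i..N. d j)" by auto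
    then have "c i = d i"
      using tails_divisible_eq_mod[OF assms(1) i] tails_divisible_eq_mod[OF assms(2) i] by simp
    then show ?case using i eq by (simp add: sum.atLeast_Suc_atMost)
  qed
  then show ?thesis
    using tails_divisible_eq_mod[OF assms(1,4)] tails_divisible_eq_mod[OF assms(2,4)] by simp
qed

text \<open>Appending zeros changes no tail sum, and the new tails have sum 0.\<close>

lemma tails_divisible_extend:
  assumes "k \<le> N" "\<And>i. i > k \<Longrightarrow> c i = 0"
  shows "tails_divisible N c \<longleftrightarrow> tails_divisible k c"
proof -
  have "(\<Sum>j=i..N. c j) = (\<Sum>j=i..k. c j)" for i
    by (rule sum.mono_neutral_right) (use assms in auto)
  moreover have "(\<Sum>j=i..k. c j) = 0" "c i = 0" if "i > k" for i
    using that assms by auto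
  ultimately show ?thesis
    using assms(1) unfolding tails_divisible_def
    by (metis atLeastAtMost_iff dvd_0_right le_trans not_le_imp_less zero_le)
qed

lemma tails_divisible_cong:
  "(\<And>i. i \<in> {1..N} \<Longrightarrow> c i = d i) \<Longrightarrow> tails_divisible N c = tails_divisible N d"
  unfolding tails_divisible_def by (intro ball_cong refl) (auto intro!: arg_cong2[where f = "(dvd)"] sum.cong)

theorem theorem3p2:
  fixes k :: nat and b :: "nat \<Rightarrow> nat"
  assumes "k > 0"
  shows "(\<exists>n. (\<forall>i\<in>{1..k}. tchoukaillon n i = b i) \<and> (\<forall>i>k. tchoukaillon n i = 0))
    \<longleftrightarrow> (\<forall>i\<in>{1..k}. b i \<le> i \<and> [(\<Sum>j=i..k. b j) = 0] (mod i))"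
    (is "?L \<longleftrightarrow> ?R")
proof -
  have "?R \<longleftrightarrow> tails_divisible k b"
    by (simp add: tails_divisible_def cong_0_iff)
  also have "\<dots> \<longleftrightarrow> ?L"
  proof
    assume "?L"
    then obtain n where n: "\<And>i. i \<in> {1..k} \<Longrightarrow> tchoukaillon n i = b i"
      "\<And>i. i > k \<Longrightarrow> tchoukaillon n i = 0" by blast
    \<comment> \<open>The invariant is available only for cutoffs that are at least
      \<open>n\<close>, and \<open>k\<close> may be smaller.\<close>
    have "tails_divisible (max n k) (tchoukaillon n)"
      using tails_divisible_tchoukaillon by simp
    then show "tails_divisible k b"
      using tails_divisible_extend[of k "max n k" "tchoukaillon n"] n
        tails_divisible_cong[of k "tchoukaillon n" b] by simp
  next
    assume b: "tails_divisible k b"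
    \<comment> \<open>Nothing is known about \<open>b\<close> beyond \<open>k\<close>, so it is
      replaced by zeros there. The total of \<open>c\<close> is the only possible number of
      stones.\<close>
    define c where "c i = (if i \<le> k then b i else 0)" for i
    define n where "n = (\<Sum>j=1..k. c j)"
    define N where "N = max n k"
    have c: "tails_divisible N c"
      using b tails_divisible_extend[of k N c] tails_divisible_cong[of k c b]
      by (simp add: N_def c_def)
    have "(\<Sum>j=1..N. c j) = n"
      unfolding n_def by (rule sum.mono_neutral_right) (auto simp: N_def c_def)
    then have eq: "tchoukaillon n i = c i" if "i \<in> {1..N}" for i
      using tails_divisible_unique[OF _ c _ that, of "tchoukaillon n"]
        tails_divisible_tchoukaillon[of n N] by (simp add: N_def)
    \<comment> \<open>Beyond \<open>N\<close> both sides vanish, since \<open>N\<close> is at least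
      \<open>n\<close> and \<open>k\<close>. Index 0 is left out because \<open>c 0\<close> is the
      arbitrary value \<open>b 0\<close>.\<close>
    have "tchoukaillon n i = c i" if "i \<ge> 1" for i
      using eq[of i] tchoukaillon_eq_0[of n i] that by (cases "i \<le> N") (auto simp: N_def c_def)
    then show ?L
      by (intro exI[of _ n]) (auto simp: c_def)
  qed
  finally show ?thesis by simp
qed

end
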